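(* Let $K\ge 1$ and $n_1,\dots,n_K\ge 1$ be integers, let $\sigma>0$, and let $\mathcal{X}$ be a random tensor with values in $\mathbb{R}^{n_1\times\cdots\times n_K}$. Assume that for each fixed choice of unit vectors $u_k\in S_{n_k-1}$ ($k=1,\dots,K$) and every $t\ge 0$, $$P\left(|\mathcal{X}(u_1,\dots,u_K)|\ge t\right)\le 2\exp\left(-\frac{t^2}{2\sigma^2}\right).$$ Then for every $\delta\in(0,1)$, with probability at least $1-\delta$, $$|||\mathcal{X}|||\le \sqrt{8\sigma^2\left(\left(\sum_{k=1}^{K}n_k\right)\log\left(\frac{2K}{K_0}\right)+\log\left(\frac{2}{\delta}\right)\right)},$$ where $K_0=\log(3/2)$.
   Context: $\log$ is the natural logarithm. $S_{n-1}$ denotes the Euclidean unit sphere in $\mathbb{R}^{n}$. For a $K$-way tensor $\mathcal{X}=(X_{i_1i_2\cdots i_K})\in\mathbb{R}^{n_1\times\cdots\times n_K}$ and vectors $u_k=(u_{k1},\dots,u_{kn_k})\in\mathbb{R}^{n_k}$, write $$\mathcal{X}(u_1,\dots,u_K)=\sum_{i_1=1}^{n_1}\cdots\sum_{i_K=1}^{n_K}X_{i_1i_2\cdots i_K}\,u_{1i_1}u_{2i_2}\cdots u_{Ki_K}.$$ The spectral norm of $\mathcal{X}$ is $$|||\mathcal{X}|||=\sup\{\mathcal{X}(u_1,\dots,u_K): u_k\in S_{n_k-1},\ k=1,\dots,K\}.$$ *)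

theory Defs
  imports "HOL-Probability.Probability"
begin

text \<open>
  The dimensions are a family \<open>n 1, \<dots>, n K\<close>. A multi-index \<open>(i\<^sub>1, \<dots>, i\<^sub>K)\<close> is an
  extensional function \<open>i\<close> on \<open>{1..K}\<close>, and a vector of \<open>\<real>\<^sup>m\<close> is an extensional function on \<open>{1..m}\<close>.
\<close>

definition multi_indices :: "nat \<Rightarrow> (nat \<Rightarrow> nat) \<Rightarrow> (nat \<Rightarrow> nat) set" where
  "multi_indices K n = (\<Pi>\<^sub>E k\<in>{1..K}. {1..n k})"

text \<open>
  The index set is finite, so the product \<open>\<sigma>\<close>-algebra is the Borel \<open>\<sigma>\<close>-algebra of the
  finite-dimensional space of tensors.
\<close>

definition tensor_space :: "nat \<Rightarrow> (nat \<Rightarrow> nat) \<Rightarrow> ((nat \<Rightarrow> nat) \<Rightarrow> real) measure" where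
  "tensor_space K n = (\<Pi>\<^sub>M i\<in>multi_indices K n. borel)"

definition unit_sphere :: "nat \<Rightarrow> (nat \<Rightarrow> real) set" where
  "unit_sphere m = {v \<in> {1..m} \<rightarrow>\<^sub>E UNIV. L2_set v {1..m} = 1}"

definition multilinear_form ::
  "nat \<Rightarrow> (nat \<Rightarrow> nat) \<Rightarrow> ((nat \<Rightarrow> nat) \<Rightarrow> real) \<Rightarrow> (nat \<Rightarrow> nat \<Rightarrow> real) \<Rightarrow> real" where
  "multilinear_form K n T u = (\<Sum>i\<in>multi_indices K n. T i * (\<Prod>k=1..K. u k (i k)))"

text \<open>
  When all \<open>n k \<ge> 1\<close> the supremum is over a nonempty set of reals that is bounded
  above (by the sum of the absolute values of the entries), so it is a genuine one.
\<close>

definition spectral_norm :: "nat \<Rightarrow> (nat \<Rightarrow> nat) \<Rightarrow> ((nat \<Rightarrow> nat) \<Rightarrow> real) \<Rightarrow> real" where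
  "spectral_norm K n T = (SUP u\<in>(\<Pi>\<^sub>E k\<in>{1..K}. unit_sphere (n k)). multilinear_form K n T u)"

definition K0 :: real where
  "K0 = ln (3 / 2)"

end

theory Submission
  imports Defs
begin

text \<open>
  A maximal \<open>\<epsilon>\<close>-separated subset of the unit sphere of \<open>\<real>\<^sup>m\<close> is an \<open>\<epsilon>\<close>-net, and comparing volumes of
  balls bounds its size by \<open>(1 + 2/\<epsilon>)\<^sup>m\<close>. A linear form on the sphere loses at most the factor
  \<open>1 - \<epsilon>\<^sup>2/2\<close> when it is maximised over the net only. Replacing the arguments of the multilinear
  form one at a time loses at most \<open>(1 - \<epsilon>\<^sup>2/2)\<^sup>K\<close>, which is at least \<open>1/2\<close> for \<open>\<epsilon> = 1/\<surd>K\<close>; the product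
  net then has at most \<open>(1 + 2\<surd>K)\<^sup>S \<le> (2K/K\<^sub>0)\<^sup>S\<close> points, where \<open>S\<close> is the sum of the dimensions, and a
  union bound finishes the proof. Applied with \<open>\<epsilon> \<rightarrow> 0\<close>, the same nets give a countable set that
  determines the spectral norm, hence its measurability.
\<close>

section \<open>Volumes of balls and the size of separated sets\<close>

text \<open>A product measure is determined by its values on boxes, and a translation pulls a box
  back to a box with shifted sides. Invariance of \<open>lborel\<close> in each coordinate therefore
  suffices.\<close>

lemma PiM_lborel_translation_invariant:
  fixes c :: "'i \<Rightarrow> real"
  assumes "finite A"
  shows "distr (PiM A (\<lambda>_. lborel)) (PiM A (\<lambda>_. lborel)) (\<lambda>x. \<lambda>i\<in>A. c i + x i)
           = PiM A (\<lambda>_. lborel)"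
proof -
  interpret product_sigma_finite "\<lambda>_::'i. lborel :: real measure"
    by standard
  show ?thesis
  proof (rule PiM_eqI)
    fix B :: "'i \<Rightarrow> real set"
    assume B: "\<And>i. i \<in> A \<Longrightarrow> B i \<in> sets lborel"
    have "(\<lambda>x. \<lambda>i\<in>A. c i + x i) -` Pi\<^sub>E A B \<inter> space (PiM A (\<lambda>_. lborel))
            = (\<Pi>\<^sub>E i\<in>A. (+) (c i) -` B i)"
      by (auto simp: space_PiM PiE_iff extensional_def)
    moreover have "(+) (c i) -` B i \<in> sets lborel" if "i \<in> A" for i
      using measurable_sets[of "(+) (c i)" lborel borel "B i"] B[OF that] by simp
    moreover have "emeasure lborel ((+) (c i) -` B i) = emeasure lborel (B i)" if "i \<in> A" for i
      using B[OF that] emeasure_distr[of "(+) (c i)" lborel borel "B i"]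
      by (simp add: lborel_distr_plus)
    moreover have "(\<lambda>x. \<lambda>i\<in>A. c i + x i) \<in> PiM A (\<lambda>_. lborel) \<rightarrow>\<^sub>M PiM A (\<lambda>_. lborel)"
      by (rule measurable_restrict) measurable
    ultimately show "emeasure (distr (PiM A (\<lambda>_. lborel)) (PiM A (\<lambda>_. lborel))
        (\<lambda>x. \<lambda>i\<in>A. c i + x i)) (Pi\<^sub>E A B) = (\<Prod>i\<in>A. emeasure lborel (B i))"
      using assms B by (simp add: emeasure_distr sets_PiM_I_finite emeasure_PiM)
  qed (use assms in auto)
qed

text \<open>The dimension is a variable, so vectors are extensional functions and the ball is a
  subset of the space of \<open>PiM\<close>. The centre need not be extensional, which permits the
  constant function 0.\<close>

definition L2_ball :: "'i set \<Rightarrow> ('i \<Rightarrow> real) \<Rightarrow> real \<Rightarrow> ('i \<Rightarrow> real) set" where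
  "L2_ball A c r = {x \<in> A \<rightarrow>\<^sub>E UNIV. L2_set (\<lambda>i. x i - c i) A \<le> r}"

lemma L2_ball_sets:
  assumes "finite A"
  shows "L2_ball A c r \<in> sets (PiM A (\<lambda>_. lborel))"
proof -
  have "(\<lambda>x. L2_set (\<lambda>i. x i - c i) A) \<in> borel_measurable (PiM A (\<lambda>_. lborel))"
    unfolding L2_set_def by measurable
  then have "{x \<in> space (PiM A (\<lambda>_. lborel)). L2_set (\<lambda>i. x i - c i) A \<le> r}
      \<in> sets (PiM A (\<lambda>_. lborel))"
    by measurable
  then show ?thesis
    by (simp add: L2_ball_def space_PiM)
qed

text \<open>Translation moves the centre to 0, where \<open>emeasure_cball_aux\<close> supplies the
  volume.\<close>

lemma emeasure_L2_ball:
  assumes "finite A" "r > 0"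
  shows "emeasure (PiM A (\<lambda>_. lborel)) (L2_ball A c r)
           = ennreal (unit_ball_vol (card A) * r ^ card A)"
proof -
  let ?L = "PiM A (\<lambda>_. lborel :: real measure)"
  let ?f = "\<lambda>x. \<lambda>i\<in>A. c i + x i"
  have "?f \<in> ?L \<rightarrow>\<^sub>M ?L"
    by (rule measurable_restrict) measurable
  then have "emeasure (distr ?L ?L ?f) (L2_ball A c r) = emeasure ?L (?f -` L2_ball A c r \<inter> space ?L)"
    using assms by (simp add: emeasure_distr L2_ball_sets)
  also have "?f -` L2_ball A c r \<inter> space ?L = {x. sqrt (\<Sum>i\<in>A. (x i)\<^sup>2) \<le> r} \<inter> space ?L"
    by (auto simp: L2_ball_def space_PiM L2_set_def)
  finally show ?thesis
    using assms unfolding PiM_lborel_translation_invariant[OF assms(1)]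
    by (simp add: emeasure_cball_aux)
qed

text \<open>The balls of radius \<epsilon>/2 around the points are disjoint and lie in the ball of
  radius 1 + \<epsilon>/2 about 0. The bound is the ratio of the two radii, raised to the
  dimension.\<close>

lemma card_separated_le:
  assumes "finite A" "\<epsilon> > 0" "finite F" "F \<subseteq> A \<rightarrow>\<^sub>E UNIV"
    and "\<And>x. x \<in> F \<Longrightarrow> L2_set x A \<le> 1"
    and sep: "\<And>x y. x \<in> F \<Longrightarrow> y \<in> F \<Longrightarrow> x \<noteq> y \<Longrightarrow> L2_set (\<lambda>i. x i - y i) A > \<epsilon>"
  shows "real (card F) \<le> (1 + 2 / \<epsilon>) ^ card A"
proof -
  let ?L = "PiM A (\<lambda>_. lborel :: real measure)"
  let ?V = "unit_ball_vol (real (card A))"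
  have disj: "disjoint_family_on (\<lambda>x. L2_ball A x (\<epsilon> / 2)) F"
  proof (clarsimp simp: disjoint_family_on_def)
    fix x y assume xy: "x \<in> F" "y \<in> F" "x \<noteq> y"
    have False if z: "z \<in> L2_ball A x (\<epsilon> / 2)" "z \<in> L2_ball A y (\<epsilon> / 2)" for z
    proof -
      have "L2_set (\<lambda>i. x i - y i) A = L2_set (\<lambda>i. (z i - y i) + - (z i - x i)) A"
        by simp
      also have "\<dots> \<le> L2_set (\<lambda>i. z i - y i) A + L2_set (\<lambda>i. - (z i - x i)) A"
        by (rule L2_set_triangle_ineq)
      also have "L2_set (\<lambda>i. - (z i - x i)) A = L2_set (\<lambda>i. z i - x i) A"
        by (simp add: L2_set_def power2_commute)
      also have "L2_set (\<lambda>i. z i - y i) A + L2_set (\<lambda>i. z i - x i) A \<le> \<epsilon> / 2 + \<epsilon> / 2"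
        using z unfolding L2_ball_def by (intro add_mono) auto
      finally show False
        using sep[OF xy] by simp
    qed
    then show "L2_ball A x (\<epsilon> / 2) \<inter> L2_ball A y (\<epsilon> / 2) = {}"
      by blast
  qed
  have sub: "(\<Union>x\<in>F. L2_ball A x (\<epsilon> / 2)) \<subseteq> L2_ball A (\<lambda>_. 0) (1 + \<epsilon> / 2)"
  proof clarify
    fix x z assume x: "x \<in> F" and z: "z \<in> L2_ball A x (\<epsilon> / 2)"
    have "L2_set z A = L2_set (\<lambda>i. x i + (z i - x i)) A"
      by simp
    also have "\<dots> \<le> L2_set x A + L2_set (\<lambda>i. z i - x i) A"
      by (rule L2_set_triangle_ineq)
    also have "\<dots> \<le> 1 + \<epsilon> / 2"
      using z assms(5)[OF x] unfolding L2_ball_def by (intro add_mono) auto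
    finally show "z \<in> L2_ball A (\<lambda>_. 0) (1 + \<epsilon> / 2)"
      using z by (simp add: L2_ball_def)
  qed
  have "ennreal (real (card F) * (?V * (\<epsilon> / 2) ^ card A)) = (\<Sum>x\<in>F. emeasure ?L (L2_ball A x (\<epsilon> / 2)))"
    using assms by (simp add: emeasure_L2_ball ennreal_mult ennreal_of_nat_eq_real_of_nat)
  also have "\<dots> = emeasure ?L (\<Union>x\<in>F. L2_ball A x (\<epsilon> / 2))"
    using assms disj by (intro sum_emeasure) (auto simp: L2_ball_sets)
  also have "\<dots> \<le> emeasure ?L (L2_ball A (\<lambda>_. 0) (1 + \<epsilon> / 2))"
    using sub assms by (intro emeasure_mono) (auto simp: L2_ball_sets)
  also have "\<dots> = ennreal (?V * (1 + \<epsilon> / 2) ^ card A)"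
    using assms by (intro emeasure_L2_ball) auto
  finally have "real (card F) * (?V * (\<epsilon> / 2) ^ card A) \<le> ?V * (1 + \<epsilon> / 2) ^ card A"
    using assms by (subst (asm) ennreal_le_iff) auto
  moreover have "?V > 0"
    by simp
  ultimately have "real (card F) * (\<epsilon> / 2) ^ card A \<le> (1 + \<epsilon> / 2) ^ card A"
    by (simp add: mult.left_commute)
  also have "(1 + \<epsilon> / 2) = (1 + 2 / \<epsilon>) * (\<epsilon> / 2)"
    using assms by (simp add: field_simps)
  finally have "real (card F) * (\<epsilon> / 2) ^ card A \<le> (1 + 2 / \<epsilon>) ^ card A * (\<epsilon> / 2) ^ card A"
    unfolding power_mult_distrib .
  then show ?thesis
    using assms by (simp add: mult_le_cancel_right)
qed

section \<open>Nets on a single sphere\<close>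

lemma unit_sphere_nonempty:
  assumes "m \<ge> 1"
  shows "unit_sphere m \<noteq> {}"
proof -
  have "(\<lambda>i\<in>{1..m}. if i = 1 then 1 else 0) \<in> unit_sphere m"
    using assms by (auto simp: unit_sphere_def L2_set_def if_distrib[of "\<lambda>x. x\<^sup>2"] cong: if_cong)
  then show ?thesis
    by blast
qed

text \<open>Separated sets have bounded size, so a largest one exists. A point of the sphere farther
  than \<epsilon> from all its members could be added to it.\<close>

lemma finite_net_unit_sphere:
  assumes "\<epsilon> > 0"
  obtains N where "finite N" "N \<subseteq> unit_sphere m" "real (card N) \<le> (1 + 2 / \<epsilon>) ^ m"
    "\<And>u. u \<in> unit_sphere m \<Longrightarrow> \<exists>v\<in>N. L2_set (\<lambda>i. u i - v i) {1..m} \<le> \<epsilon>"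
proof -
  define sep where "sep F \<longleftrightarrow> finite F \<and> F \<subseteq> unit_sphere m \<and>
    (\<forall>x\<in>F. \<forall>y\<in>F. x \<noteq> y \<longrightarrow> L2_set (\<lambda>i. x i - y i) {1..m} > \<epsilon>)" for F
  have bound: "real (card F) \<le> (1 + 2 / \<epsilon>) ^ m" if "sep F" for F
  proof -
    have "F \<subseteq> {1..m} \<rightarrow>\<^sub>E UNIV" "\<And>x. x \<in> F \<Longrightarrow> L2_set x {1..m} \<le> 1"
      using that by (auto simp: sep_def unit_sphere_def)
    then show ?thesis
      using card_separated_le[of "{1..m}" \<epsilon> F] that assms by (simp add: sep_def)
  qed
  then have "\<forall>F. sep F \<longrightarrow> card F < Suc (nat \<lfloor>(1 + 2 / \<epsilon>) ^ m\<rfloor>)"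
    by (auto simp: less_Suc_eq_le intro!: le_nat_floor)
  moreover have "sep {}"
    by (simp add: sep_def)
  ultimately obtain N where N: "sep N" and max: "\<And>F. sep F \<Longrightarrow> card F \<le> card N"
    using ex_has_greatest_nat[of sep "{}" card] by blast
  have "\<exists>v\<in>N. L2_set (\<lambda>i. u i - v i) {1..m} \<le> \<epsilon>" if u: "u \<in> unit_sphere m" for u
  proof (rule ccontr)
    assume "\<not> ?thesis"
    then have far: "L2_set (\<lambda>i. u i - v i) {1..m} > \<epsilon>" if "v \<in> N" for v
      using that by force
    have "L2_set (\<lambda>i. u i - v i) {1..m} = L2_set (\<lambda>i. v i - u i) {1..m}" for v
      by (simp add: L2_set_def power2_commute)
    then have "sep (insert u N)"
      using N u far unfolding sep_def by auto
    \<comment> \<open>A member of \<open>N\<close> has distance 0 from itself, so \<open>u\<close>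
      is new and the cardinality really grows.\<close>
    moreover have "u \<notin> N"
      using far[of u] assms by (auto simp: L2_set_def)
    ultimately show False
      using max[of "insert u N"] N by (simp add: sep_def)
  qed
  then show thesis
    using that[of N] N bound by (auto simp: sep_def)
qed

text \<open>
  It suffices to approximate the normalised coefficient vector: for unit vectors at distance \<open>d\<close>
  the inner product is \<open>1 - d\<^sup>2 / 2\<close>. The loss is thus quadratic in \<open>\<epsilon>\<close>.
\<close>
lemma linear_form_le_net:
  assumes "u \<in> unit_sphere m" "0 < \<epsilon>" "\<epsilon> \<le> 1"
    and "N \<subseteq> unit_sphere m"
    and net: "\<And>u. u \<in> unit_sphere m \<Longrightarrow> \<exists>v\<in>N. L2_set (\<lambda>i. u i - v i) {1..m} \<le> \<epsilon>"
  shows "\<exists>v\<in>N. (1 - \<epsilon>\<^sup>2 / 2) * (\<Sum>i=1..m. a i * u i) \<le> (\<Sum>i=1..m. a i * v i)"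
proof -
  define \<alpha> where "\<alpha> = L2_set a {1..m}"
  have "\<epsilon>\<^sup>2 \<le> 1"
    using assms by (simp add: power_le_one)
  have "(\<Sum>i=1..m. a i * u i) \<le> (\<Sum>i=1..m. \<bar>a i\<bar> * \<bar>u i\<bar>)"
    by (intro sum_mono) (simp flip: abs_mult)
  also have "\<dots> \<le> \<alpha> * L2_set u {1..m}"
    unfolding \<alpha>_def by (rule L2_set_mult_ineq)
  finally have au: "(\<Sum>i=1..m. a i * u i) \<le> \<alpha>"
    using assms by (simp add: unit_sphere_def)
  show ?thesis
  proof (cases "\<alpha> = 0")
    case True
    then have "\<forall>i\<in>{1..m}. a i = 0"
      by (simp add: \<alpha>_def L2_set_eq_0_iff)
    \<comment> \<open>Both sums vanish, so any point of \<open>N\<close> serves; the net property at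
      \<open>u\<close> provides one.\<close>
    then show ?thesis
      using net[OF assms(1)] by auto
  next
    case False
    then have "\<alpha> > 0"
      by (simp add: \<alpha>_def less_le)
    have sq: "(\<Sum>i=1..m. (x i)\<^sup>2) = (L2_set x {1..m})\<^sup>2" for x :: "nat \<Rightarrow> real"
      by (simp add: L2_set_def sum_nonneg)
    define w where "w = (\<lambda>i\<in>{1..m}. a i / \<alpha>)"
    have "L2_set w {1..m} = L2_set (\<lambda>i. a i * inverse \<alpha>) {1..m}"
      by (intro L2_set_cong) (auto simp: w_def divide_inverse)
    also have "\<dots> = 1"
      using \<open>\<alpha> > 0\<close> by (subst L2_set_left_distrib[symmetric]) (auto simp: \<alpha>_def)
    finally have w: "w \<in> unit_sphere m"
      by (simp add: unit_sphere_def w_def)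
    then obtain v where v: "v \<in> N" and wv: "L2_set (\<lambda>i. w i - v i) {1..m} \<le> \<epsilon>"
      using net by blast
    have "v \<in> unit_sphere m"
      using v assms by blast
    have "(\<Sum>i=1..m. (w i - v i)\<^sup>2)
        = (\<Sum>i=1..m. (w i)\<^sup>2) + (\<Sum>i=1..m. (v i)\<^sup>2) - 2 * (\<Sum>i=1..m. w i * v i)"
      by (simp add: power2_diff sum.distrib sum_subtractf sum_distrib_left mult.assoc)
    also have "\<dots> = 2 - 2 * (\<Sum>i=1..m. w i * v i)"
      using w \<open>v \<in> unit_sphere m\<close> unfolding sq by (simp add: unit_sphere_def)
    finally have "2 - 2 * (\<Sum>i=1..m. w i * v i) \<le> \<epsilon>\<^sup>2"
      using power_mono[OF wv, of 2] unfolding sq by simp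
    then have "1 - \<epsilon>\<^sup>2 / 2 \<le> (\<Sum>i=1..m. w i * v i)"
      by simp
    \<comment> \<open>By Cauchy-Schwarz the form at \<open>u\<close> is at most \<alpha>, while at
      \<open>v\<close> it equals \<alpha> times the inner product of \<open>w\<close> and
      \<open>v\<close>.\<close>
    have "(1 - \<epsilon>\<^sup>2 / 2) * (\<Sum>i=1..m. a i * u i) \<le> (1 - \<epsilon>\<^sup>2 / 2) * \<alpha>"
      using au \<open>\<epsilon>\<^sup>2 \<le> 1\<close> by (intro mult_left_mono) auto
    also have "\<dots> \<le> (\<Sum>i=1..m. w i * v i) * \<alpha>"
      using \<open>1 - \<epsilon>\<^sup>2 / 2 \<le> _\<close> \<open>\<alpha> > 0\<close> by (intro mult_right_mono) auto
    also have "\<dots> = (\<Sum>i=1..m. a i * v i)"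
      using \<open>\<alpha> > 0\<close> by (simp add: w_def sum_distrib_right)
    finally show ?thesis
      using v by blast
  qed
qed

section \<open>Multilinear forms and product nets\<close>

lemma finite_multi_indices: "finite (multi_indices K n)"
  unfolding multi_indices_def by (intro finite_PiE) auto

text \<open>Grouping the multi-indices by their \<open>k\<close>-th entry collects the coefficient
  of each \<open>w j\<close>; the remaining factors do not involve \<open>w\<close>.\<close>

lemma multilinear_form_linear_coordinate:
  assumes "k \<in> {1..K}"
  obtains a where "\<And>w. multilinear_form K n T (u(k := w)) = (\<Sum>j=1..n k. a j * w j)"
proof
  fix w
  let ?I = "multi_indices K n"
  let ?c = "\<lambda>i. T i * (\<Prod>l\<in>{1..K} - {k}. u l (i l))"
  have "multilinear_form K n T (u(k := w)) = (\<Sum>i\<in>?I. ?c i * w (i k))"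
    unfolding multilinear_form_def
  proof (intro sum.cong refl)
    fix i
    have "(\<Prod>l=1..K. (u(k := w)) l (i l)) = w (i k) * (\<Prod>l\<in>{1..K} - {k}. (u(k := w)) l (i l))"
      using assms by (subst prod.remove[of _ k]) auto
    also have "(\<Prod>l\<in>{1..K} - {k}. (u(k := w)) l (i l)) = (\<Prod>l\<in>{1..K} - {k}. u l (i l))"
      by (intro prod.cong) auto
    finally show "T i * (\<Prod>l=1..K. (u(k := w)) l (i l)) = ?c i * w (i k)"
      by simp
  qed
  also have "\<dots> = (\<Sum>j=1..n k. \<Sum>i | i \<in> ?I \<and> i k = j. ?c i * w (i k))"
    using assms finite_multi_indices
    by (intro sum.group[symmetric]) (auto simp: multi_indices_def)
  also have "\<dots> = (\<Sum>j=1..n k. (\<Sum>i | i \<in> ?I \<and> i k = j. ?c i) * w j)"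
    by (simp add: sum_distrib_right)
  finally show "multilinear_form K n T (u(k := w))
      = (\<Sum>j=1..n k. (\<Sum>i | i \<in> ?I \<and> i k = j. ?c i) * w j)" .
qed

lemma multilinear_form_le_product_net:
  assumes "0 < \<epsilon>" "\<epsilon> \<le> 1"
    and N: "\<And>k. k \<in> {1..K} \<Longrightarrow> N k \<subseteq> unit_sphere (n k)"
    and net: "\<And>k u. k \<in> {1..K} \<Longrightarrow> u \<in> unit_sphere (n k)
          \<Longrightarrow> \<exists>v\<in>N k. L2_set (\<lambda>i. u i - v i) {1..n k} \<le> \<epsilon>"
    and u: "u \<in> (\<Pi>\<^sub>E k\<in>{1..K}. unit_sphere (n k))"
  shows "\<exists>v\<in>(\<Pi>\<^sub>E k\<in>{1..K}. N k).
    (1 - \<epsilon>\<^sup>2 / 2) ^ K * multilinear_form K n T u \<le> multilinear_form K n T v"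
proof -
  let ?c = "1 - \<epsilon>\<^sup>2 / 2"
  have "\<epsilon>\<^sup>2 \<le> 1"
    using assms by (simp add: power_le_one)
  \<comment> \<open>The first \<open>j\<close> arguments already lie in their nets, the others still
    anywhere on their spheres. Each induction step moves one more argument and costs one factor
    \<open>?c\<close>.\<close>
  have "\<exists>v\<in>(\<Pi>\<^sub>E k\<in>{1..K}. if k \<le> j then N k else unit_sphere (n k)).
      ?c ^ j * multilinear_form K n T u \<le> multilinear_form K n T v" if "j \<le> K" for j
    using that
  proof (induction j)
    case 0
    have "(\<Pi>\<^sub>E k\<in>{1..K}. if k \<le> 0 then N k else unit_sphere (n k))
        = (\<Pi>\<^sub>E k\<in>{1..K}. unit_sphere (n k))"
      by (intro PiE_cong) auto
    then show ?case
      using u by auto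
  next
    case (Suc j)
    then obtain v where v: "v \<in> (\<Pi>\<^sub>E k\<in>{1..K}. if k \<le> j then N k else unit_sphere (n k))"
      and uv: "?c ^ j * multilinear_form K n T u \<le> multilinear_form K n T v"
      by auto
    let ?k = "Suc j"
    have k: "?k \<in> {1..K}"
      using Suc by auto
    obtain a where a: "\<And>w. multilinear_form K n T (v(?k := w)) = (\<Sum>i=1..n ?k. a i * w i)"
      using multilinear_form_linear_coordinate[OF k] by blast
    have "v ?k \<in> unit_sphere (n ?k)"
      using PiE_mem[OF v k] by simp
    then obtain w where w: "w \<in> N ?k"
      and le: "?c * (\<Sum>i=1..n ?k. a i * v ?k i) \<le> (\<Sum>i=1..n ?k. a i * w i)"
      using linear_form_le_net[OF _ assms(1,2) N[OF k] net[OF k], of "v ?k" a] by auto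
    have "?c ^ ?k * multilinear_form K n T u = ?c * (?c ^ j * multilinear_form K n T u)"
      by simp
    also have "\<dots> \<le> ?c * multilinear_form K n T v"
      using uv \<open>\<epsilon>\<^sup>2 \<le> 1\<close> by (intro mult_left_mono) auto
    \<comment> \<open>Updating \<open>v\<close> at \<open>?k\<close> with its own value changes
      nothing, so the linear formula at \<open>v ?k\<close> gives the form at
      \<open>v\<close>.\<close>
    also have "\<dots> \<le> multilinear_form K n T (v(?k := w))"
      using le a[of "v ?k"] a[of w] by simp
    finally have "?c ^ ?k * multilinear_form K n T u \<le> multilinear_form K n T (v(?k := w))" .
    moreover have "v(?k := w) \<in> (\<Pi>\<^sub>E k\<in>{1..K}. if k \<le> ?k then N k else unit_sphere (n k))"
      using v w k by (auto simp: PiE_iff extensional_def le_Suc_eq)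
    ultimately show ?case
      by blast
  qed
  from this[of K] have "\<exists>v\<in>(\<Pi>\<^sub>E k\<in>{1..K}. if k \<le> K then N k else unit_sphere (n k)).
      ?c ^ K * multilinear_form K n T u \<le> multilinear_form K n T v"
    by simp
  also have "(\<Pi>\<^sub>E k\<in>{1..K}. if k \<le> K then N k else unit_sphere (n k)) = (\<Pi>\<^sub>E k\<in>{1..K}. N k)"
    by (intro PiE_cong) auto
  finally show ?thesis .
qed

text \<open>The set \<open>V\<close> is chosen before \<open>T\<close>. One deterministic net thus
  serves all values of the random tensor, as the union bound requires.\<close>

lemma finite_product_net:
  assumes "0 < \<epsilon>" "\<epsilon> \<le> 1"
  obtains V where "finite V" "V \<subseteq> (\<Pi>\<^sub>E k\<in>{1..K}. unit_sphere (n k))"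
    "real (card V) \<le> (1 + 2 / \<epsilon>) ^ (\<Sum>k=1..K. n k)"
    "\<And>T u. u \<in> (\<Pi>\<^sub>E k\<in>{1..K}. unit_sphere (n k)) \<Longrightarrow>
       \<exists>v\<in>V. (1 - \<epsilon>\<^sup>2 / 2) ^ K * multilinear_form K n T u \<le> multilinear_form K n T v"
proof -
  have "\<exists>N. finite N \<and> N \<subseteq> unit_sphere m \<and> real (card N) \<le> (1 + 2 / \<epsilon>) ^ m \<and>
      (\<forall>u\<in>unit_sphere m. \<exists>v\<in>N. L2_set (\<lambda>i. u i - v i) {1..m} \<le> \<epsilon>)" for m
    using finite_net_unit_sphere[OF assms(1), of m] by metis
  then obtain N where N: "\<And>m. finite (N m)" "\<And>m. N m \<subseteq> unit_sphere m"
      "\<And>m. real (card (N m)) \<le> (1 + 2 / \<epsilon>) ^ m"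
      "\<And>m u. u \<in> unit_sphere m \<Longrightarrow> \<exists>v\<in>N m. L2_set (\<lambda>i. u i - v i) {1..m} \<le> \<epsilon>"
    by metis
  show thesis
  proof (rule that[of "\<Pi>\<^sub>E k\<in>{1..K}. N (n k)"])
    show "finite (\<Pi>\<^sub>E k\<in>{1..K}. N (n k))"
      using N(1) by (intro finite_PiE) auto
    show "(\<Pi>\<^sub>E k\<in>{1..K}. N (n k)) \<subseteq> (\<Pi>\<^sub>E k\<in>{1..K}. unit_sphere (n k))"
      using N(2) by (intro PiE_mono) auto
    have "real (card (\<Pi>\<^sub>E k\<in>{1..K}. N (n k))) = (\<Prod>k=1..K. real (card (N (n k))))"
      by (simp add: card_PiE)
    also have "\<dots> \<le> (\<Prod>k=1..K. (1 + 2 / \<epsilon>) ^ n k)"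
      using N(3) by (intro prod_mono) auto
    finally show "real (card (\<Pi>\<^sub>E k\<in>{1..K}. N (n k))) \<le> (1 + 2 / \<epsilon>) ^ (\<Sum>k=1..K. n k)"
      by (simp add: power_sum)
    show "\<exists>v\<in>\<Pi>\<^sub>E k\<in>{1..K}. N (n k).
        (1 - \<epsilon>\<^sup>2 / 2) ^ K * multilinear_form K n T u \<le> multilinear_form K n T v"
      if "u \<in> (\<Pi>\<^sub>E k\<in>{1..K}. unit_sphere (n k))" for T u
      by (rule multilinear_form_le_product_net[OF assms N(2) N(4) that])
  qed
qed

lemma finite_half_norming_net:
  assumes "K \<ge> 1"
  obtains V where "finite V" "V \<subseteq> (\<Pi>\<^sub>E k\<in>{1..K}. unit_sphere (n k))"
    "real (card V) \<le> (2 * real K / K0) ^ (\<Sum>k=1..K. n k)"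
    "\<And>T u. u \<in> (\<Pi>\<^sub>E k\<in>{1..K}. unit_sphere (n k)) \<Longrightarrow>
       \<exists>v\<in>V. multilinear_form K n T u \<le> 2 * \<bar>multilinear_form K n T v\<bar>"
proof -
  \<comment> \<open>With \<epsilon> squared equal to 1/K, Bernoulli's inequality bounds the total
    loss factor below by 1 - K/(2K) = 1/2.\<close>
  define \<epsilon> where "\<epsilon> = 1 / sqrt (real K)"
  have \<epsilon>: "0 < \<epsilon>" "\<epsilon> \<le> 1" "\<epsilon>\<^sup>2 = 1 / real K"
    using assms by (auto simp: \<epsilon>_def power_divide)
  obtain V where V: "finite V" "V \<subseteq> (\<Pi>\<^sub>E k\<in>{1..K}. unit_sphere (n k))"
    "real (card V) \<le> (1 + 2 / \<epsilon>) ^ (\<Sum>k=1..K. n k)"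
    "\<And>T u. u \<in> (\<Pi>\<^sub>E k\<in>{1..K}. unit_sphere (n k)) \<Longrightarrow>
       \<exists>v\<in>V. (1 - \<epsilon>\<^sup>2 / 2) ^ K * multilinear_form K n T u \<le> multilinear_form K n T v"
    using finite_product_net[OF \<epsilon>(1,2)] by metis
  have "0 < K0" "K0 \<le> 1 / 2"
    using ln_le_minus_one[of "3 / 2"] by (auto simp: K0_def)
  \<comment> \<open>As K is at least 1, 1 + 2 sqrt K is at most 3K, hence at most 4K; then
    \<open>K0 \<le> 1 / 2\<close> gives the stated base.\<close>
  have "sqrt (real K) \<le> real K"
    using assms by (intro real_le_lsqrt) (auto simp: power2_eq_square)
  then have "1 + 2 / \<epsilon> \<le> 4 * real K"
    using assms by (simp add: \<epsilon>_def)
  also have "\<dots> \<le> 2 * real K / K0"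
    using \<open>0 < K0\<close> \<open>K0 \<le> 1 / 2\<close> assms by (simp add: field_simps)
  finally have "(1 + 2 / \<epsilon>) ^ (\<Sum>k=1..K. n k) \<le> (2 * real K / K0) ^ (\<Sum>k=1..K. n k)"
    using \<epsilon> by (intro power_mono) auto
  moreover have "1 / 2 \<le> (1 - \<epsilon>\<^sup>2 / 2) ^ K"
  proof -
    have "1 / 2 = 1 + real K * (- (\<epsilon>\<^sup>2 / 2))"
      using assms by (simp add: \<epsilon>(3))
    also have "\<dots> \<le> (1 + - (\<epsilon>\<^sup>2 / 2)) ^ K"
      using \<epsilon> power_le_one[of \<epsilon> 2] by (intro Bernoulli_inequality) auto
    finally show ?thesis
      by simp
  qed
  \<comment> \<open>For negative \<open>x\<close> the right-hand side is nonnegative anyway; this is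
    what the absolute value is for.\<close>
  then have half: "x \<le> 2 * \<bar>y\<bar>" if "(1 - \<epsilon>\<^sup>2 / 2) ^ K * x \<le> y" for x y
    using that mult_right_mono[of "1 / 2" "(1 - \<epsilon>\<^sup>2 / 2) ^ K" x] by (cases "x \<ge> 0") auto
  ultimately have "real (card V) \<le> (2 * real K / K0) ^ (\<Sum>k=1..K. n k)"
    using V(3) by linarith
  with V(1,2) show thesis
  proof (rule that)
    fix T u assume "u \<in> (\<Pi>\<^sub>E k\<in>{1..K}. unit_sphere (n k))"
    from V(4)[OF this, of T] half
    show "\<exists>v\<in>V. multilinear_form K n T u \<le> 2 * \<bar>multilinear_form K n T v\<bar>"
      by blast
  qed
qed

text \<open>Take the union of product nets with mesh 1/(j+1). Their loss factors tend to 1, so an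
  upper bound on the union passes to all unit vectors in the limit.\<close>

lemma countable_norming_set:
  obtains D where "countable D" "D \<subseteq> (\<Pi>\<^sub>E k\<in>{1..K}. unit_sphere (n k))"
    "\<And>T t u. (\<And>v. v \<in> D \<Longrightarrow> multilinear_form K n T v \<le> t) \<Longrightarrow>
       u \<in> (\<Pi>\<^sub>E k\<in>{1..K}. unit_sphere (n k)) \<Longrightarrow> multilinear_form K n T u \<le> t"
proof -
  let ?S = "\<Pi>\<^sub>E k\<in>{1..K}. unit_sphere (n k)"
  let ?c = "\<lambda>j. (1 - (1 / real (Suc j))\<^sup>2 / 2) ^ K"
  have "\<exists>V. finite V \<and> V \<subseteq> ?S \<and> (\<forall>T. \<forall>u\<in>?S. \<exists>v\<in>V.
      ?c j * multilinear_form K n T u \<le> multilinear_form K n T v)" for j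
    using finite_product_net[of "1 / real (Suc j)" K n] by (simp, metis)
  then obtain V where V: "\<And>j. finite (V j)" "\<And>j. V j \<subseteq> ?S"
      "\<And>j T u. u \<in> ?S \<Longrightarrow> \<exists>v\<in>V j. ?c j * multilinear_form K n T u \<le> multilinear_form K n T v"
    by metis
  show thesis
  proof (rule that[of "\<Union>j. V j"])
    show "countable (\<Union>j. V j)"
      using V(1) by (auto intro: countable_finite)
    show "(\<Union>j. V j) \<subseteq> ?S"
      using V(2) by blast
    show "multilinear_form K n T u \<le> t"
      if "\<And>v. v \<in> (\<Union>j. V j) \<Longrightarrow> multilinear_form K n T v \<le> t" "u \<in> ?S" for T t u
    proof (rule LIMSEQ_le_const2)
      have "(\<lambda>j. (1 - (1 / real (Suc j))\<^sup>2 / 2) ^ K * multilinear_form K n T u)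
          \<longlonglongrightarrow> (1 - 0\<^sup>2 / 2) ^ K * multilinear_form K n T u"
        using LIMSEQ_Suc[OF lim_1_over_n[where 'a = real]] by (intro tendsto_intros) auto
      then show "(\<lambda>j. ?c j * multilinear_form K n T u) \<longlonglongrightarrow> multilinear_form K n T u"
        by simp
      show "\<exists>j0. \<forall>j\<ge>j0. ?c j * multilinear_form K n T u \<le> t"
        using V(3)[OF that(2)] that(1) by (meson UNIV_I UN_I order_trans)
    qed
  qed
qed

section \<open>Measurability and the tail bound\<close>

lemma borel_measurable_multilinear_form:
  "(\<lambda>T. multilinear_form K n T u) \<in> borel_measurable (tensor_space K n)"
  unfolding multilinear_form_def
proof (rule borel_measurable_sum)
  fix i assume "i \<in> multi_indices K n"
  then have "(\<lambda>T. T i) \<in> borel_measurable (tensor_space K n)"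
    unfolding tensor_space_def by (rule measurable_component_singleton)
  then show "(\<lambda>T. T i * (\<Prod>k=1..K. u k (i k))) \<in> borel_measurable (tensor_space K n)"
    by (rule borel_measurable_times) (rule borel_measurable_const)
qed

text \<open>A real supremum behaves as expected only on a nonempty set that is bounded above. A
  finite half-norming net gives a bound: the sum of the doubled absolute values over the
  net.\<close>

lemma spectral_norm_le_iff:
  assumes "K \<ge> 1" "\<And>k. k \<in> {1..K} \<Longrightarrow> n k \<ge> 1"
  shows "spectral_norm K n T \<le> t \<longleftrightarrow>
    (\<forall>u\<in>(\<Pi>\<^sub>E k\<in>{1..K}. unit_sphere (n k)). multilinear_form K n T u \<le> t)"
  unfolding spectral_norm_def
proof (rule cSUP_le_iff)
  show "(\<Pi>\<^sub>E k\<in>{1..K}. unit_sphere (n k)) \<noteq> {}"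
    using assms unit_sphere_nonempty by (simp add: PiE_eq_empty_iff)
  obtain V where V: "finite V"
    "\<And>u. u \<in> (\<Pi>\<^sub>E k\<in>{1..K}. unit_sphere (n k)) \<Longrightarrow>
       \<exists>v\<in>V. multilinear_form K n T u \<le> 2 * \<bar>multilinear_form K n T v\<bar>"
    using finite_half_norming_net[OF assms(1)] by metis
  show "bdd_above ((multilinear_form K n T) ` (\<Pi>\<^sub>E k\<in>{1..K}. unit_sphere (n k)))"
  proof (rule bdd_aboveI2)
    fix u assume "u \<in> (\<Pi>\<^sub>E k\<in>{1..K}. unit_sphere (n k))"
    then obtain v where "v \<in> V" and "multilinear_form K n T u \<le> 2 * \<bar>multilinear_form K n T v\<bar>"
      using V(2) by blast
    note this(2)
    also have "2 * \<bar>multilinear_form K n T v\<bar> \<le> (\<Sum>v\<in>V. 2 * \<bar>multilinear_form K n T v\<bar>)"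
      using \<open>v \<in> V\<close> V(1) by (intro member_le_sum) auto
    finally show "multilinear_form K n T u \<le> (\<Sum>v\<in>V. 2 * \<bar>multilinear_form K n T v\<bar>)" .
  qed
qed

text \<open>The supremum runs over an uncountable set, but a countable norming set that is the same
  for all tensors turns the event into a countable intersection.\<close>

lemma spectral_norm_le_sets:
  assumes "K \<ge> 1" "\<And>k. k \<in> {1..K} \<Longrightarrow> n k \<ge> 1" "X \<in> M \<rightarrow>\<^sub>M tensor_space K n"
  shows "{\<omega> \<in> space M. spectral_norm K n (X \<omega>) \<le> t} \<in> sets M"
proof -
  obtain D where D: "countable D" "D \<subseteq> (\<Pi>\<^sub>E k\<in>{1..K}. unit_sphere (n k))"
    "\<And>T t u. (\<And>v. v \<in> D \<Longrightarrow> multilinear_form K n T v \<le> t) \<Longrightarrow>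
       u \<in> (\<Pi>\<^sub>E k\<in>{1..K}. unit_sphere (n k)) \<Longrightarrow> multilinear_form K n T u \<le> t"
    using countable_norming_set[of K n] by metis
  have "spectral_norm K n T \<le> t \<longleftrightarrow> (\<forall>v\<in>D. multilinear_form K n T v \<le> t)" for T
    using spectral_norm_le_iff[where n = n, OF assms(1,2)] D(2,3) by blast
  moreover have "{\<omega> \<in> space M. multilinear_form K n (X \<omega>) v \<le> t} \<in> sets M" for v
    using measurable_compose[OF assms(3) borel_measurable_multilinear_form] by measurable
  ultimately show ?thesis
    using D(1) by (simp add: sets.sets_Collect_countable_Ball)
qed

theorem theorem1:
  fixes M :: "'w measure"
    and K :: nat
    and n :: "nat \<Rightarrow> nat"
    and \<sigma> \<delta> :: real
    and X :: "'w \<Rightarrow> (nat \<Rightarrow> nat) \<Rightarrow> real"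
  assumes "prob_space M"
    and "K \<ge> 1"
    and "\<And>k. k \<in> {1..K} \<Longrightarrow> n k \<ge> 1"
    and "\<sigma> > 0"
    and "X \<in> M \<rightarrow>\<^sub>M tensor_space K n"
    and "\<And>u t. u \<in> (\<Pi>\<^sub>E k\<in>{1..K}. unit_sphere (n k)) \<Longrightarrow> t \<ge> 0 \<Longrightarrow>
           measure M {\<omega> \<in> space M. \<bar>multilinear_form K n (X \<omega>) u\<bar> \<ge> t}
             \<le> 2 * exp (- (t\<^sup>2 / (2 * \<sigma>\<^sup>2)))"
    and "0 < \<delta>" and "\<delta> < 1"
  shows "measure M {\<omega> \<in> space M. spectral_norm K n (X \<omega>)
           \<le> sqrt (8 * \<sigma>\<^sup>2 * (real (\<Sum>k=1..K. n k) * ln (2 * real K / K0) + ln (2 / \<delta>)))}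
         \<ge> 1 - \<delta>"
proof -
  interpret prob_space M
    by fact
  define S where "S = (\<Sum>k=1..K. n k)"
  define q where "q = 2 * real K / K0"
  \<comment> \<open>The first term pays for the size of the net, the second for the failure
    probability and the factor 2 in the tail hypothesis.\<close>
  define L where "L = real S * ln q + ln (2 / \<delta>)"
  define t where "t = sqrt (8 * \<sigma>\<^sup>2 * L)"
  define good where "good = {\<omega> \<in> space M. spectral_norm K n (X \<omega>) \<le> t}"
  \<comment> \<open>The threshold is halved because passing to the net may lose a factor 2.\<close>
  define bad where "bad v = {\<omega> \<in> space M. \<bar>multilinear_form K n (X \<omega>) v\<bar> \<ge> t / 2}" for v
  obtain V where V: "finite V" "V \<subseteq> (\<Pi>\<^sub>E k\<in>{1..K}. unit_sphere (n k))"
    "real (card V) \<le> q ^ S"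
    "\<And>T u. u \<in> (\<Pi>\<^sub>E k\<in>{1..K}. unit_sphere (n k)) \<Longrightarrow>
       \<exists>v\<in>V. multilinear_form K n T u \<le> 2 * \<bar>multilinear_form K n T v\<bar>"
    using finite_half_norming_net[OF assms(2), of n] unfolding S_def q_def by metis
  have "0 < K0" "K0 \<le> 1 / 2"
    using ln_le_minus_one[of "3 / 2"] by (auto simp: K0_def)
  then have "q \<ge> 1"
    using assms(2) by (simp add: q_def field_simps)
  then have "L \<ge> 0"
    using assms by (simp add: L_def)
  \<comment> \<open>Since \<open>L\<close> is nonnegative, the square root squares back. The
    constant 8 is 4 from the halved threshold times 2 from the Gaussian exponent, so each tail
    becomes \<open>2 * exp (- L)\<close>.\<close>
  then have "t \<ge> 0" and t2: "(t / 2)\<^sup>2 / (2 * \<sigma>\<^sup>2) = L"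
    using assms by (auto simp: t_def power_divide)
  have bad: "bad v \<in> events" for v
    unfolding bad_def using measurable_compose[OF assms(5) borel_measurable_multilinear_form]
    by measurable
  have good: "good \<in> events"
    unfolding good_def using spectral_norm_le_sets[OF assms(2,3,5)] by simp
  have "space M - good \<subseteq> (\<Union>v\<in>V. bad v)"
  proof
    fix \<omega> assume "\<omega> \<in> space M - good"
    then have \<omega>: "\<omega> \<in> space M" "\<not> spectral_norm K n (X \<omega>) \<le> t"
      by (auto simp: good_def)
    have "spectral_norm K n (X \<omega>) \<le> t \<longleftrightarrow>
        (\<forall>u\<in>(\<Pi>\<^sub>E k\<in>{1..K}. unit_sphere (n k)). multilinear_form K n (X \<omega>) u \<le> t)"
      by (rule spectral_norm_le_iff[OF assms(2,3)])
    with \<omega>(2) obtain u where u: "u \<in> (\<Pi>\<^sub>E k\<in>{1..K}. unit_sphere (n k))"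
      and "\<not> multilinear_form K n (X \<omega>) u \<le> t"
      by metis
    moreover obtain v where "v \<in> V"
      "multilinear_form K n (X \<omega>) u \<le> 2 * \<bar>multilinear_form K n (X \<omega>) v\<bar>"
      using V(4)[OF u] by metis
    ultimately show "\<omega> \<in> (\<Union>v\<in>V. bad v)"
      using \<omega>(1) by (auto simp: bad_def intro!: bexI[of _ v])
  qed
  then have "prob (space M - good) \<le> prob (\<Union>v\<in>V. bad v)"
    using V(1) bad by (intro finite_measure_mono) auto
  also have "\<dots> \<le> (\<Sum>v\<in>V. prob (bad v))"
    using V(1) bad by (intro finite_measure_subadditive_finite) auto
  also have "\<dots> \<le> (\<Sum>v\<in>V. 2 * exp (- L))"
    using assms(6)[of _ "t / 2"] V(2) \<open>t \<ge> 0\<close> unfolding bad_def t2[symmetric]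
    by (intro sum_mono) auto
  also have "\<dots> = real (card V) * (2 * exp (- L))"
    by simp
  also have "\<dots> \<le> q ^ S * (2 * exp (- L))"
    using V(3) by (intro mult_right_mono) auto
  \<comment> \<open>\<open>exp (- L)\<close> is \<delta>/2 divided by \<open>q ^ S\<close>, so the
    bound on the net size cancels exactly.\<close>
  also have "\<dots> = \<delta>"
  proof -
    have "exp (real S * ln q) = q ^ S" "exp (ln (2 / \<delta>)) = 2 / \<delta>"
      using \<open>q \<ge> 1\<close> assms(7) by (simp_all add: exp_of_nat_mult)
    then have "exp (- L) = inverse (q ^ S * (2 / \<delta>))"
      unfolding L_def exp_minus exp_add by simp
    then show ?thesis
      using \<open>q \<ge> 1\<close> assms(7) by simp
  qed
  finally have "1 - \<delta> \<le> prob good"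
    using prob_compl[OF good] by simp
  then show ?thesis
    by (simp add: good_def t_def L_def q_def S_def)
qed

end
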